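(* Let $f$ be a relation on a Hausdorff uniform space $(X,\mathcal U)$ whose topology is second countable. There exist bounded, uniformly continuous Lyapunov functions $L_\ell,L_m:X\to\mathbb R$ for $f$ such that $1_X\cup\mathcal A_{\mathcal U}f=\ \le_{L_\ell}$, $1_X\cup\mathcal C_{\mathcal U}f=\ \le_{L_m}$, and $$x\in\mathcal A_{\mathcal U}f(y)\ \Longrightarrow\ L_\ell(y)<L_\ell(x)\ \text{ unless } y\in\mathcal A_{\mathcal U}f(x),$$ $$x\in\mathcal C_{\mathcal U}f(y)\ \Longrightarrow\ L_m(y)<L_m(x)\ \text{ unless } y\in\mathcal C_{\mathcal U}f(x).$$ In particular, $|L_\ell|_{\mathcal A_{\mathcal U}f}=|\mathcal A_{\mathcal U}f|$ and $|L_m|_{\mathcal C_{\mathcal U}f}=|\mathcal C_{\mathcal U}f|$. Furthermore, there exists a metric $d\in\Gamma_m(X)\cap\Gamma(\mathcal U)$ such that $L_\ell$ and $L_m$ are Lipschitz functions on $(X,d)$ and $$\mathcal A_{\mathcal U}f=\mathcal A_df\quad\text{and}\quad\mathcal C_{\mathcal U}f=\mathcal C_df .$$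
   Context: A relation on $X$ is a subset of $X\times X$; $F(x)=\{y:(x,y)\in F\}$; $F^{-1}=\{(y,x):(x,y)\in F\}$; $|F|=\{x:(x,x)\in F\}$; $1_X$ is the diagonal. All metrics and pseudo-metrics are assumed bounded. The gage $\Gamma(\mathcal U)$ is the set of all bounded pseudo-metrics $d$ on $X$ with $\{(x,y):d(x,y)<\epsilon\}\in\mathcal U$ for every $\epsilon>0$. $\Gamma_m(X)$ is the set of (bounded) metrics on $X$ compatible with the topology. For a pseudo-metric $d$: $\mathcal C_df$ is the set of $(x,y)$ such that for every $\epsilon>0$ there are $n\ge1$ and $(a_1,b_1),\dots,(a_n,b_n)\in f$ with $\max(d(x,a_1),d(b_1,a_2),\dots,d(b_{n-1},a_n),d(b_n,y))<\epsilon$; $\mathcal A_df$ is the set of $(x,y)$ such that for every $\epsilon>0$ there are $n\ge1$ and $(a_1,b_1),\dots,(a_n,b_n)\in f$ with $d(x,a_1)+\sum_{i=1}^{n-1}d(b_i,a_{i+1})+d(b_n,y)<\epsilon$. $\mathcal C_{\mathcal U}f=\bigcap_{d\in\Gamma(\mathcal U)}\mathcal C_df$ and $\mathcal A_{\mathcal U}f=\bigcap_{d\in\Gamma(\mathcal U)}\mathcal A_df$. $\le_L\ =\{(x,y):L(x)\le L(y)\}$; a Lyapunov function for $F$ is a continuous $L:X\to\mathbb R$ with $F\subset\ \le_L$. A point $x$ is $F$-regular for $L$ if $L(z)<L(x)<L(w)$ for all $z\in F^{-1}(x)$, $w\in F(x)$ (vacuous conditions hold), and $F$-critical otherwise; $|L|_F$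 is the set of $F$-critical points.
   Formalization: The equalities of 1_X ∪ A_U f and 1_X ∪ C_U f with ≤_L are proved as inclusions ⊂: ≤_L is total, so equality fails e.g. for f = ∅ on the real line; with the strictness clauses, equality follows whenever the left side is total. *)

theory Defs
  imports "HOL-Analysis.Analysis"
begin

text \<open>
  The uniform space \<open>(X, U)\<close> is a type of class \<open>uniform_space\<close>: \<open>U\<close> is the filter
  \<open>uniformity\<close>, and the topology is the one it induces.  A relation \<open>F\<close> on \<open>X\<close> is a
  set of pairs, and \<open>y \<in> F(x)\<close> is \<open>(x, y) \<in> F\<close>.
\<close>

definition bounded_pseudometric :: "('a \<Rightarrow> 'a \<Rightarrow> real) \<Rightarrow> bool" where
  "bounded_pseudometric d \<longleftrightarrow>
     (\<forall>x y. 0 \<le> d x y) \<and> (\<forall>x. d x x = 0) \<and> (\<forall>x y. d x y = d y x) \<and>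
     (\<forall>x y z. d x z \<le> d x y + d y z) \<and> (\<exists>B. \<forall>x y. d x y \<le> B)"

definition gage :: "('a::uniform_space \<Rightarrow> 'a \<Rightarrow> real) set" where
  "gage = {d. bounded_pseudometric d \<and>
     (\<forall>\<epsilon>>0. eventually (\<lambda>(x, y). d x y < \<epsilon>) uniformity)}"

definition compatible_metrics :: "('a::topological_space \<Rightarrow> 'a \<Rightarrow> real) set" where
  "compatible_metrics = {d. Metric_space UNIV d \<and> Metric_space.mbounded UNIV d UNIV \<and>
     Metric_space.mtopology UNIV d = euclidean}"

text \<open>
  For \<open>cs = [(a\<^sub>1, b\<^sub>1), \<dots>, (a\<^sub>n, b\<^sub>n)]\<close> with \<open>n \<ge> 1\<close>, \<open>gaps d x cs y\<close> is
  \<open>[d x a\<^sub>1, d b\<^sub>1 a\<^sub>2, \<dots>, d b\<^bsub>n-1\<^esub> a\<^sub>n, d b\<^sub>n y]\<close>.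
\<close>

fun gaps :: "('a \<Rightarrow> 'a \<Rightarrow> real) \<Rightarrow> 'a \<Rightarrow> ('a \<times> 'a) list \<Rightarrow> 'a \<Rightarrow> real list" where
  "gaps d x [] y = [d x y]"
| "gaps d x ((a, b) # cs) y = d x a # gaps d b cs y"

definition chain_rel_d :: "('a \<Rightarrow> 'a \<Rightarrow> real) \<Rightarrow> ('a \<times> 'a) set \<Rightarrow> ('a \<times> 'a) set" where
  "chain_rel_d d f = {(x, y). \<forall>\<epsilon>>0. \<exists>cs. cs \<noteq> [] \<and> set cs \<subseteq> f \<and>
     Max (set (gaps d x cs y)) < \<epsilon>}"

definition achain_rel_d :: "('a \<Rightarrow> 'a \<Rightarrow> real) \<Rightarrow> ('a \<times> 'a) set \<Rightarrow> ('a \<times> 'a) set" where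
  "achain_rel_d d f = {(x, y). \<forall>\<epsilon>>0. \<exists>cs. cs \<noteq> [] \<and> set cs \<subseteq> f \<and>
     sum_list (gaps d x cs y) < \<epsilon>}"

definition chain_rel :: "('a::uniform_space \<times> 'a) set \<Rightarrow> ('a \<times> 'a) set" where
  "chain_rel f = (\<Inter>d\<in>gage. chain_rel_d d f)"

definition achain_rel :: "('a::uniform_space \<times> 'a) set \<Rightarrow> ('a \<times> 'a) set" where
  "achain_rel f = (\<Inter>d\<in>gage. achain_rel_d d f)"

text \<open>The set \<open>|F|\<close> of the points related to themselves.\<close>

definition cyclic_set :: "('a \<times> 'a) set \<Rightarrow> 'a set" where
  "cyclic_set F = {x. (x, x) \<in> F}"

definition le_rel :: "('a \<Rightarrow> real) \<Rightarrow> ('a \<times> 'a) set" where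
  "le_rel L = {(x, y). L x \<le> L y}"

definition lyapunov_function ::
    "('a::topological_space \<times> 'a) set \<Rightarrow> ('a \<Rightarrow> real) \<Rightarrow> bool" where
  "lyapunov_function F L \<longleftrightarrow> continuous_on UNIV L \<and> F \<subseteq> le_rel L"

definition regular_point :: "('a \<times> 'a) set \<Rightarrow> ('a \<Rightarrow> real) \<Rightarrow> 'a \<Rightarrow> bool" where
  "regular_point F L x \<longleftrightarrow>
     (\<forall>z. (z, x) \<in> F \<longrightarrow> L z < L x) \<and> (\<forall>w. (x, w) \<in> F \<longrightarrow> L x < L w)"

definition critical_set :: "('a \<times> 'a) set \<Rightarrow> ('a \<Rightarrow> real) \<Rightarrow> 'a set" where
  "critical_set F L = {x. \<not> regular_point F L x}"

text \<open>
  Erratum: the source prints \<open>Id \<union> achain_rel f = le_rel L\<close> and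
  \<open>Id \<union> chain_rel f = le_rel L\<close> for a single real-valued \<open>L\<close>.  As \<open>le_rel L\<close> relates any
  two points in at least one direction, these equations fail as soon as two points are
  incomparable under the left-hand side, for example for \<open>f = {}\<close> on the real line.  The
  theorem is stated with \<open>\<subseteq>\<close>; together with the strictness clauses this gives the
  equations for all pairs of points that are comparable under the left-hand side.
\<close>

end

theory Submission
  imports Defs
begin

text \<open>
  Off the diagonal, each of the relations is the zero set of a quasi-pseudo-metric: the infimum, over
  chains of pairs in \<open>f\<close>, of the sum or of the maximum of the gaps. Allowing also the empty
  chain, this infimum \<open>E\<close> satisfies \<open>E \<le> d\<close> and the triangle inequality, so \<open>E (-) z\<close> is
  1-Lipschitz and nondecreasing along the relation; a weighted sum over a dense sequence of
  \<open>z\<close> is the Lyapunov function. A single \<open>d\<close> suffices because the complement of each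
  \<open>d\<close>-relation is open: by Lindelof's theorem countably many pseudo-metrics of the gage
  determine both intersections and the topology, and a weighted sum of them dominates each
  one up to a constant.
\<close>

section \<open>Costs of chains\<close>

text \<open>With \<open>g\<close> equal to \<open>(+)\<close> or \<open>max\<close> this is the sum
  or the maximum of the gaps, so one argument serves both relations. The recursion ends in the last
  gap itself, so the empty chain from \<open>x\<close> to \<open>y\<close> costs
  \<open>d x y\<close>.\<close>

fun path_cost :: "(real \<Rightarrow> real \<Rightarrow> real) \<Rightarrow> ('a \<Rightarrow> 'a \<Rightarrow> real) \<Rightarrow> 'a \<Rightarrow> ('a \<times> 'a) list \<Rightarrow> 'a \<Rightarrow> real" where
  "path_cost g d x [] y = d x y"
| "path_cost g d x ((a, b) # cs) y = g (d x a) (path_cost g d b cs y)"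

definition cost_rel ::
    "(real \<Rightarrow> real \<Rightarrow> real) \<Rightarrow> ('a \<Rightarrow> 'a \<Rightarrow> real) \<Rightarrow> ('a \<times> 'a) set \<Rightarrow> ('a \<times> 'a) set" where
  "cost_rel g d f = {(x, y). \<forall>\<epsilon>>0. \<exists>cs. cs \<noteq> [] \<and> set cs \<subseteq> f \<and> path_cost g d x cs y < \<epsilon>}"

text \<open>Here the empty chain is admitted, so that the infimum is at most \<open>d x y\<close>.\<close>

definition cost_inf ::
    "(real \<Rightarrow> real \<Rightarrow> real) \<Rightarrow> ('a \<Rightarrow> 'a \<Rightarrow> real) \<Rightarrow> ('a \<times> 'a) set \<Rightarrow> 'a \<Rightarrow> 'a \<Rightarrow> real" where
  "cost_inf g d f x y = (INF cs\<in>{cs. set cs \<subseteq> f}. path_cost g d x cs y)"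

lemma cost_plus: "path_cost (+) d x cs y = sum_list (gaps d x cs y)"
  by (induction d x cs y rule: gaps.induct) auto

lemma gaps_nonempty: "gaps d x cs y \<noteq> []"
  by (cases "(d, x, cs, y)" rule: gaps.cases) auto

lemma cost_max: "path_cost max d x cs y = Max (set (gaps d x cs y))"
  by (induction d x cs y rule: gaps.induct) (auto simp: gaps_nonempty)

lemma achain_rel_d_eq: "achain_rel_d d f = cost_rel (+) d f"
  by (simp add: achain_rel_d_def cost_rel_def cost_plus)

lemma chain_rel_d_eq: "chain_rel_d d f = cost_rel max d f"
  by (simp add: chain_rel_d_def cost_rel_def cost_max)

section \<open>Pseudo-metrics of the gage and their small neighbourhoods\<close>

lemma bounded_pseudometricD:
  assumes "bounded_pseudometric d"
  shows "0 \<le> d x y" "d x x = 0" "d x y = d y x" "d x z \<le> d x y + d y z"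
  using assms unfolding bounded_pseudometric_def by blast+

lemma gage_bounded_pseudometric: "d \<in> gage \<Longrightarrow> bounded_pseudometric d"
  by (simp add: gage_def)

lemma gage_eventually: "d \<in> gage \<Longrightarrow> 0 < \<epsilon> \<Longrightarrow> eventually (\<lambda>(x, y). d x y < \<epsilon>) uniformity"
  by (simp add: gage_def)

lemma gage_eventually_nhds:
  assumes "d \<in> gage" "0 < \<epsilon>"
  shows "eventually (\<lambda>y. d x y < \<epsilon>) (nhds x)"
  using gage_eventually[OF assms] unfolding eventually_nhds_uniformity
  by (auto elim: eventually_mono)

text \<open>Common properties of addition and maximum. The laws \<open>add_left\<close> and
  \<open>add_right\<close> yield the triangle inequality for costs, and \<open>scale\<close> makes
  the relations insensitive to multiplying \<open>d\<close> by a positive constant.\<close>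

locale chain_cost =
  fixes g :: "real \<Rightarrow> real \<Rightarrow> real"
  assumes mono: "s \<le> s' \<Longrightarrow> t \<le> t' \<Longrightarrow> g s t \<le> g s' t'"
    and zero: "0 \<le> t \<Longrightarrow> g 0 t = t"
    and add_left: "0 \<le> u \<Longrightarrow> g (s + u) t \<le> g s t + u"
    and add_right: "0 \<le> u \<Longrightarrow> g s (t + u) \<le> g s t + u"
    and scale: "0 < k \<Longrightarrow> g (k * s) (k * t) = k * g s t"
begin

lemma cost_nonneg:
  assumes d: "bounded_pseudometric d"
  shows "0 \<le> path_cost g d x cs y"
proof (induction cs arbitrary: x)
  case Nil
  show ?case using bounded_pseudometricD[OF d] by simp
next
  case (Cons c cs)
  have "g 0 0 \<le> g (d x (fst c)) (path_cost g d (snd c) cs y)"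
    using Cons bounded_pseudometricD[OF d] by (intro mono) auto
  then show ?case
    using zero[of 0] by (cases c) simp
qed

text \<open>Only the first gap depends on the starting point. It grows by at most
  \<open>d x y\<close>, and \<open>add_left\<close> passes this bound on to the whole cost.\<close>

lemma cost_left:
  assumes d: "bounded_pseudometric d"
  shows "path_cost g d x cs z \<le> d x y + path_cost g d y cs z"
proof (cases cs)
  case Nil
  then show ?thesis using bounded_pseudometricD(4)[OF d] by simp
next
  case (Cons c cs')
  obtain a b where c: "c = (a, b)" by force
  have "g (d x a) (path_cost g d b cs' z) \<le> g (d y a + d x y) (path_cost g d b cs' z)"
    using bounded_pseudometricD(4)[OF d, of x a y] by (intro mono) auto
  also have "\<dots> \<le> g (d y a) (path_cost g d b cs' z) + d x y"
    using bounded_pseudometricD[OF d] by (intro add_left) auto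
  finally show ?thesis using Cons c by simp
qed

text \<open>The gap at the junction is at most the last gap into \<open>y\<close> plus the first gap
  out of \<open>y\<close>; \<open>add_right\<close> carries the surplus outward through the
  induction. The bound is a sum even for \<open>max\<close>, which is what a triangle inequality
  asks for.\<close>

lemma cost_append:
  assumes d: "bounded_pseudometric d"
  shows "path_cost g d x (cs @ cs') z \<le> path_cost g d x cs y + path_cost g d y cs' z"
proof (induction cs arbitrary: x)
  case Nil
  show ?case using cost_left[OF d] by simp
next
  case (Cons c cs)
  obtain a b where c: "c = (a, b)" by force
  have "g (d x a) (path_cost g d b (cs @ cs') z) \<le> g (d x a) (path_cost g d b cs y + path_cost g d y cs' z)"
    using Cons by (intro mono) auto
  also have "\<dots> \<le> g (d x a) (path_cost g d b cs y) + path_cost g d y cs' z"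
    using cost_nonneg[OF d] by (intro add_right) auto
  finally show ?case using c by simp
qed

lemma cost_right:
  assumes "bounded_pseudometric d"
  shows "path_cost g d x cs z \<le> path_cost g d x cs y + d y z"
  using cost_append[OF assms, of x cs "[]" z y] by simp

lemma cost_scale:
  assumes "0 < K" and le: "\<And>x y. d' x y \<le> K * d x y"
  shows "path_cost g d' x cs y \<le> K * path_cost g d x cs y"
proof (induction cs arbitrary: x)
  case Nil
  show ?case using le by simp
next
  case (Cons c cs)
  obtain a b where c: "c = (a, b)" by force
  have "g (d' x a) (path_cost g d' b cs y) \<le> g (K * d x a) (K * path_cost g d b cs y)"
    using Cons le by (intro mono) auto
  then show ?case using c scale[OF \<open>0 < K\<close>] by simp
qed

text \<open>The relation asks for arbitrarily small costs, so the constant is absorbed by passing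
  from \<open>\<epsilon>\<close> to \<open>\<epsilon> / K\<close>. Hence a pseudo-metric that
  dominates another up to a constant has the smaller relation.\<close>

lemma cost_rel_scale:
  assumes K: "0 < K" and le: "\<And>x y. d' x y \<le> K * d x y"
  shows "cost_rel g d f \<subseteq> cost_rel g d' f"
proof (rule subrelI)
  fix x y assume xy: "(x, y) \<in> cost_rel g d f"
  have "\<exists>cs. cs \<noteq> [] \<and> set cs \<subseteq> f \<and> path_cost g d' x cs y < \<epsilon>" if "0 < \<epsilon>" for \<epsilon>
  proof -
    have "0 < \<epsilon> / K" using K that by simp
    then obtain cs where cs: "cs \<noteq> []" "set cs \<subseteq> f" "path_cost g d x cs y < \<epsilon> / K"
      using xy unfolding cost_rel_def by blast
    have "path_cost g d' x cs y < \<epsilon>"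
      using cost_scale[of K d' d x cs y, OF K le] cs(3) K by (simp add: field_simps)
    with cs show ?thesis by blast
  qed
  then show "(x, y) \<in> cost_rel g d' f" by (simp add: cost_rel_def)
qed

lemma cost_rel_trans:
  assumes d: "bounded_pseudometric d"
    and xy: "(x, y) \<in> cost_rel g d f" and yz: "(y, z) \<in> cost_rel g d f"
  shows "(x, z) \<in> cost_rel g d f"
proof -
  have "\<exists>cs. cs \<noteq> [] \<and> set cs \<subseteq> f \<and> path_cost g d x cs z < \<epsilon>" if "0 < \<epsilon>" for \<epsilon>
  proof -
    have e: "0 < \<epsilon> / 2" using that by simp
    obtain cs where cs: "cs \<noteq> []" "set cs \<subseteq> f" "path_cost g d x cs y < \<epsilon> / 2"
      using xy e unfolding cost_rel_def by blast
    obtain cs' where cs': "set cs' \<subseteq> f" "path_cost g d y cs' z < \<epsilon> / 2"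
      using yz e unfolding cost_rel_def by blast
    have "path_cost g d x (cs @ cs') z < \<epsilon>"
      using cost_append[OF d, of x cs cs' z y] cs(3) cs'(2) by simp
    with cs cs' show ?thesis by (intro exI[of _ "cs @ cs'"]) auto
  qed
  then show ?thesis by (auto simp: cost_rel_def)
qed

lemma subset_cost_rel:
  assumes d: "bounded_pseudometric d"
  shows "f \<subseteq> cost_rel g d f"
proof -
  have "path_cost g d a [(a, b)] b = 0" for a b
    using bounded_pseudometricD(2)[OF d] zero[of 0] by simp
  then have "\<exists>cs. cs \<noteq> [] \<and> set cs \<subseteq> f \<and> path_cost g d a cs b < \<epsilon>" if "(a, b) \<in> f" "0 < \<epsilon>" for a b \<epsilon>
    using that by (intro exI[of _ "[(a, b)]"]) simp
  then show ?thesis by (auto simp: cost_rel_def)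
qed

text \<open>Non-membership is witnessed by one \<open>\<epsilon>\<close> below which no chain gets.
  Moving each endpoint by less than \<open>\<epsilon> / 3\<close> changes the cost of a chain by
  less than \<open>2 * \<epsilon> / 3\<close>, so for nearby pairs no chain gets below
  \<open>\<epsilon> / 3\<close>.\<close>

lemma open_Compl_cost_rel:
  fixes d :: "'a::uniform_space \<Rightarrow> 'a \<Rightarrow> real"
  assumes "d \<in> gage"
  shows "open (- cost_rel g d f)"
proof (rule topological_space_class.openI)
  note d = gage_bounded_pseudometric[OF assms]
  fix p assume "p \<in> - cost_rel g d f"
  then obtain x y \<epsilon> where p: "p = (x, y)" and \<epsilon>: "0 < \<epsilon>"
    and no: "\<And>cs. cs \<noteq> [] \<Longrightarrow> set cs \<subseteq> f \<Longrightarrow> \<not> path_cost g d x cs y < \<epsilon>"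
    unfolding cost_rel_def by (cases p) auto
  have e: "0 < \<epsilon> / 3" using \<epsilon> by simp
  obtain S where S: "open S" "x \<in> S" "\<And>x'. x' \<in> S \<Longrightarrow> d x x' < \<epsilon> / 3"
    using gage_eventually_nhds[OF assms e, of x] unfolding eventually_nhds by blast
  obtain T where T: "open T" "y \<in> T" "\<And>y'. y' \<in> T \<Longrightarrow> d y y' < \<epsilon> / 3"
    using gage_eventually_nhds[OF assms e, of y] unfolding eventually_nhds by blast
  have "(x', y') \<notin> cost_rel g d f" if "x' \<in> S" "y' \<in> T" for x' y'
  proof
    assume "(x', y') \<in> cost_rel g d f"
    then obtain cs where cs: "cs \<noteq> []" "set cs \<subseteq> f" "path_cost g d x' cs y' < \<epsilon> / 3"
      using e unfolding cost_rel_def by blast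
    have "path_cost g d x cs y < \<epsilon>"
      using cost_left[OF d, of x cs y x'] cost_right[OF d, of x' cs y y'] cs(3)
        S(3)[OF that(1)] T(3)[OF that(2)] bounded_pseudometricD(3)[OF d, of y y'] by simp
    then show False using no cs by blast
  qed
  then show "\<exists>W. open W \<and> p \<in> W \<and> W \<subseteq> - cost_rel g d f"
    using S T p by (intro exI[of _ "S \<times> T"]) (auto intro: open_Times)
qed

section \<open>The infimum of chain costs as a quasi-pseudo-metric\<close>

lemma cost_inf_le:
  assumes "bounded_pseudometric d" "set cs \<subseteq> f"
  shows "cost_inf g d f x y \<le> path_cost g d x cs y"
  unfolding cost_inf_def
proof (rule cINF_lower)
  show "bdd_below ((\<lambda>cs. path_cost g d x cs y) ` {cs. set cs \<subseteq> f})"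
    by (rule bdd_belowI2[of _ 0]) (rule cost_nonneg[OF assms(1)])
qed (use assms in simp)

lemma cost_inf_lessE:
  assumes "cost_inf g d f x y < t"
  obtains cs where "set cs \<subseteq> f" "path_cost g d x cs y < t"
proof -
  have "(\<lambda>cs. path_cost g d x cs y) ` {cs. set cs \<subseteq> f} \<noteq> {}"
    by (auto intro: exI[of _ "[]"])
  then show thesis
    using cInf_lessD[of "(\<lambda>cs. path_cost g d x cs y) ` {cs. set cs \<subseteq> f}" t] assms that
    unfolding cost_inf_def by blast
qed

lemma cost_inf_nonneg:
  assumes "bounded_pseudometric d"
  shows "0 \<le> cost_inf g d f x y"
  unfolding cost_inf_def
proof (rule cINF_greatest)
  show "{cs. set cs \<subseteq> f} \<noteq> {}"
    by (auto intro: exI[of _ "[]"])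
qed (rule cost_nonneg[OF assms])

lemma cost_inf_le_dist:
  assumes "bounded_pseudometric d"
  shows "cost_inf g d f x y \<le> d x y"
  using cost_inf_le[OF assms, of "[]"] by simp

lemma cost_inf_triangle:
  assumes d: "bounded_pseudometric d"
  shows "cost_inf g d f x z \<le> cost_inf g d f x y + cost_inf g d f y z"
proof (rule field_le_epsilon)
  fix e :: real assume "0 < e"
  then have e: "t < t + e / 2" for t by simp
  obtain cs where cs: "set cs \<subseteq> f" "path_cost g d x cs y < cost_inf g d f x y + e / 2"
    using cost_inf_lessE[OF e] .
  obtain cs' where cs': "set cs' \<subseteq> f" "path_cost g d y cs' z < cost_inf g d f y z + e / 2"
    using cost_inf_lessE[OF e] .
  have "cost_inf g d f x z \<le> path_cost g d x (cs @ cs') z"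
    using cs cs' by (intro cost_inf_le[OF d]) auto
  also have "\<dots> \<le> path_cost g d x cs y + path_cost g d y cs' z"
    by (rule cost_append[OF d])
  finally show "cost_inf g d f x z \<le> cost_inf g d f x y + cost_inf g d f y z + e"
    using cs cs' by simp
qed

lemma cost_rel_imp_cost_inf_eq_0:
  assumes d: "bounded_pseudometric d" and "(x, y) \<in> cost_rel g d f"
  shows "cost_inf g d f x y = 0"
proof (rule antisym)
  show "cost_inf g d f x y \<le> 0"
  proof (rule field_le_epsilon)
    fix e :: real assume "0 < e"
    then obtain cs where "set cs \<subseteq> f" "path_cost g d x cs y < e"
      using assms(2) unfolding cost_rel_def by blast
    then show "cost_inf g d f x y \<le> 0 + e"
      using cost_inf_le[OF d, of cs f x y] by simp
  qed
qed (rule cost_inf_nonneg[OF d])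

lemma cost_inf_eq_0_imp_cost_rel:
  assumes "cost_inf g d f x y = 0" "0 < d x y"
  shows "(x, y) \<in> cost_rel g d f"
proof -
  have "\<exists>cs. cs \<noteq> [] \<and> set cs \<subseteq> f \<and> path_cost g d x cs y < \<epsilon>" if "0 < \<epsilon>" for \<epsilon>
  proof -
    \<comment> \<open>The bound \<open>d x y\<close> excludes the empty chain, whose cost is exactly
      \<open>d x y\<close>.\<close>
    have "cost_inf g d f x y < min \<epsilon> (d x y)" using that assms by simp
    then obtain cs where cs: "set cs \<subseteq> f" "path_cost g d x cs y < min \<epsilon> (d x y)"
      by (rule cost_inf_lessE)
    then have "cs \<noteq> []" by auto
    with cs show ?thesis by auto
  qed
  then show ?thesis by (auto simp: cost_rel_def)
qed

end

interpretation sum_cost: chain_cost "(+)"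
  by standard (simp_all add: distrib_left)

interpretation max_cost: chain_cost max
proof
  show "max (k * s) (k * t) = k * max s t" if "0 < k" for k s t :: real
    using max_mult_distrib_left[of k s t] that by simp
qed linarith+

section \<open>Lyapunov functions\<close>

lemma compatible_metrics_Metric_space: "d \<in> compatible_metrics \<Longrightarrow> Metric_space UNIV d"
  by (simp add: compatible_metrics_def)

lemma compatible_metrics_dense_sequence:
  fixes d :: "'a::second_countable_topology \<Rightarrow> 'a \<Rightarrow> real"
  assumes d: "d \<in> compatible_metrics"
  obtains z :: "nat \<Rightarrow> 'a" where "\<And>y \<epsilon>. 0 < \<epsilon> \<Longrightarrow> \<exists>n. d y (z n) < \<epsilon>"
proof -
  interpret Metric_space UNIV d using compatible_metrics_Metric_space[OF d] .
  obtain D :: "'a set" where D: "countable D" "\<And>U. open U \<Longrightarrow> U \<noteq> {} \<Longrightarrow> \<exists>z\<in>D. z \<in> U"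
    using countable_dense_exists by blast
  have "D \<noteq> {}" using D(2)[of UNIV] by auto
  have "\<exists>n. d y (from_nat_into D n) < \<epsilon>" if "0 < \<epsilon>" for y \<epsilon>
  proof -
    have top: "mtopology = euclidean" using d by (simp add: compatible_metrics_def)
    have "open (mball y \<epsilon>)" using openin_mball[of y \<epsilon>] unfolding top by simp
    moreover have "y \<in> mball y \<epsilon>" using that by simp
    ultimately obtain z where "z \<in> D" "d y z < \<epsilon>"
      using D(2)[of "mball y \<epsilon>"] by auto
    then show ?thesis using from_nat_into_surj[OF D(1)] by metis
  qed
  then show thesis using that by blast
qed

text \<open>
  The dense sequence detects every strict increase, since \<open>E x y > 0 = E y y\<close> persists
  when the second argument is moved from \<open>y\<close> to a nearby point.
\<close>

lemma quasimetric_lyapunov: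
  fixes d :: "'a::second_countable_topology \<Rightarrow> 'a \<Rightarrow> real"
  assumes comp: "d \<in> compatible_metrics" and pm: "bounded_pseudometric d"
    and nonneg: "\<And>x y. 0 \<le> E x y" and le: "\<And>x y. E x y \<le> d x y"
    and tri: "\<And>x y z. E x z \<le> E x y + E y z"
  obtains L :: "'a \<Rightarrow> real" where "bounded (range L)" "\<And>x y. \<bar>L x - L y\<bar> \<le> 2 * d x y"
    "\<And>x y. E x y = 0 \<Longrightarrow> L x \<le> L y" "\<And>x y. E x y = 0 \<Longrightarrow> 0 < E y x \<Longrightarrow> L x < L y"
proof -
  obtain z :: "nat \<Rightarrow> 'a" where z: "\<And>y \<epsilon>. 0 < \<epsilon> \<Longrightarrow> \<exists>n. d y (z n) < \<epsilon>"
    using compatible_metrics_dense_sequence[OF comp] by blast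
  obtain B where B: "\<And>x y. d x y \<le> B"
    using pm unfolding bounded_pseudometric_def by blast
  \<comment> \<open>The weights have total 2, whence the Lipschitz constant 2 and the bound
    \<open>2 * B\<close> for the sum \<open>L\<close>.\<close>
  define u where "u x n = (1/2) ^ n * E x (z n)" for x n
  have "(\<lambda>n. (1/2) ^ n * c) sums (2 * c)" for c :: real
    using sums_mult2[OF geometric_sums[of "1/2 :: real"], of c] by simp
  then have geo_summ: "summable (\<lambda>n. (1/2) ^ n * c)"
    and geo: "(\<Sum>n. (1/2) ^ n * c) = 2 * c" for c :: real
    unfolding sums_iff by blast+
  have u_nonneg: "0 \<le> u x n" and u_le: "u x n \<le> (1/2) ^ n * B" for x n
    using nonneg le[of x "z n"] B[of x "z n"] by (auto simp: u_def intro!: mult_left_mono)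
  have summ: "summable (u x)" for x
    by (rule summable_comparison_test'[OF geo_summ[of B], of 0])
      (use u_nonneg u_le in auto)
  define L where "L x = suminf (u x)" for x
  have L_diff: "L x - L y \<le> 2 * d x y" for x y
  proof -
    have "u x n - u y n \<le> (1/2) ^ n * d x y" for n
    proof -
      have "(1/2) ^ n * (E x (z n) - E y (z n)) \<le> (1/2) ^ n * d x y"
        using tri[of x "z n" y] le[of x y] by (intro mult_left_mono) auto
      then show ?thesis by (simp add: u_def right_diff_distrib)
    qed
    then have "(\<Sum>n. u x n - u y n) \<le> (\<Sum>n. (1/2) ^ n * d x y)"
      by (rule suminf_le[OF _ summable_diff[OF summ summ] geo_summ])
    then show ?thesis
      unfolding geo L_def suminf_diff[OF summ summ] .
  qed
  have mono: "u x n \<le> u y n" if "E x y = 0" for x y n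
    using tri[of x "z n" y] that by (simp add: u_def)
  show thesis
  proof (rule that[of L])
    have "0 \<le> L x" for x
      unfolding L_def by (rule suminf_nonneg[OF summ u_nonneg])
    moreover have "L x \<le> 2 * B" for x
      using suminf_le[OF u_le summ geo_summ] unfolding L_def geo .
    ultimately show "bounded (range L)"
      by (intro boundedI[of _ "2 * B"]) auto
    show "\<bar>L x - L y\<bar> \<le> 2 * d x y" for x y
      using L_diff[of x y] L_diff[of y x] bounded_pseudometricD(3)[OF pm, of x y] by simp
    show "L x \<le> L y" if "E x y = 0" for x y
      unfolding L_def by (intro suminf_le summ mono that)
    show "L x < L y" if xy: "E x y = 0" and pos: "0 < E y x" for x y
    proof -
      \<comment> \<open>The dense point is taken near the smaller point \<open>x\<close>. Then
        \<open>E x (z n)\<close> lies below half of \<open>E y x\<close> and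
        \<open>E y (z n)\<close> above it, so the \<open>n\<close>-th term of the series increases
        strictly.\<close>
      obtain n where n: "d x (z n) < E y x / 2" using z[of "E y x / 2" x] pos by auto
      have "E y x \<le> E y (z n) + E (z n) x" by (rule tri)
      moreover have "E (z n) x \<le> d x (z n)"
        using le[of "z n" x] bounded_pseudometricD(3)[OF pm] by metis
      ultimately have "E x (z n) < E y (z n)"
        using n le[of x "z n"] by simp
      then have "0 < u y n - u x n" by (simp add: u_def)
      then have "0 < (\<Sum>n. u y n - u x n)"
        by (intro suminf_pos2 summable_diff summ) (auto simp: mono xy)
      then show ?thesis
        using suminf_diff[OF summ summ, of y x] by (simp add: L_def)
    qed
  qed
qed

lemma uniformly_continuous_on_gage:
  fixes L :: "'a::uniform_space \<Rightarrow> 'b::metric_space"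
  assumes "d \<in> gage" and "\<And>x y. dist (L x) (L y) \<le> K * d x y"
  shows "uniformly_continuous_on UNIV L"
  unfolding uniformly_continuous_on_uniformity filterlim_iff
proof (intro allI impI)
  fix P :: "'b \<times> 'b \<Rightarrow> bool"
  assume "eventually P uniformity"
  then obtain e where e: "0 < e" "\<And>x y. dist x y < e \<Longrightarrow> P (x, y)"
    unfolding eventually_uniformity_metric by blast
  \<comment> \<open>The sign of \<open>K\<close> is unknown; a positive constant makes
    \<open>e / K'\<close> a valid radius.\<close>
  define K' where "K' = max K 1"
  have K': "0 < K'" "\<And>x y. dist (L x) (L y) \<le> K' * d x y"
  proof -
    show "dist (L x) (L y) \<le> K' * d x y" for x y
      using assms(2)[of x y] bounded_pseudometricD(1)[OF gage_bounded_pseudometric[OF assms(1)]]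
      unfolding K'_def by (meson max.cobounded1 mult_right_mono order_trans)
  qed (simp add: K'_def)
  have "P (L x, L y)" if "d x y < e / K'" for x y
    using e K'(1) K'(2)[of x y] that by (intro e(2)) (simp add: field_simps)
  moreover have "eventually (\<lambda>(x, y). d x y < e / K') uniformity"
    using e K' by (intro gage_eventually[OF assms(1)]) auto
  ultimately show "eventually (\<lambda>p. P (case p of (x, y) \<Rightarrow> (L x, L y))) (uniformity_on UNIV)"
    by (simp, elim eventually_mono) auto
qed

text \<open>A pair that makes \<open>x\<close> critical shows no strict increase of
  \<open>L\<close>. By the second assumption it is then related in both directions, and transitivity
  closes it to a loop at \<open>x\<close>. Conversely, a loop would require
  \<open>L x < L x\<close>.\<close>

lemma critical_set_eq_cyclic_set:
  assumes "\<And>x y z. (x, y) \<in> F \<Longrightarrow> (y, z) \<in> F \<Longrightarrow> (x, z) \<in> F"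
    and "\<And>x y. (y, x) \<in> F \<Longrightarrow> (x, y) \<notin> F \<Longrightarrow> L y < L x"
  shows "critical_set F L = cyclic_set F"
proof -
  have "\<not> regular_point F L x" if "(x, x) \<in> F" for x
    using that by (auto simp: regular_point_def)
  moreover have "(x, x) \<in> F" if crit: "\<not> regular_point F L x" for x
  proof (cases "\<exists>z. (z, x) \<in> F \<and> L x \<le> L z")
    case True
    then show ?thesis using assms by (meson leD)
  next
    case False
    then obtain w where "(x, w) \<in> F" "L w \<le> L x"
      using crit by (auto simp: regular_point_def not_less)
    then show ?thesis using assms by (meson leD)
  qed
  ultimately show ?thesis by (auto simp: critical_set_def cyclic_set_def)
qed

lemma (in chain_cost) lyapunov_exists:
  fixes d :: "'a::{uniform_space, second_countable_topology} \<Rightarrow> 'a \<Rightarrow> real"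
  assumes d: "d \<in> compatible_metrics \<inter> gage"
  shows "\<exists>L. lyapunov_function f L \<and> bounded (range L) \<and> uniformly_continuous_on UNIV L \<and>
    Id \<union> cost_rel g d f \<subseteq> le_rel L \<and>
    (\<forall>x y. (y, x) \<in> cost_rel g d f \<longrightarrow> (x, y) \<notin> cost_rel g d f \<longrightarrow> L y < L x) \<and>
    critical_set (cost_rel g d f) L = cyclic_set (cost_rel g d f) \<and>
    Lipschitz_continuous_map (metric (UNIV, d)) euclidean_metric L"
proof -
  have comp: "d \<in> compatible_metrics" and dg: "d \<in> gage" using d by auto
  note pm = gage_bounded_pseudometric[OF dg]
  interpret Metric_space UNIV d using compatible_metrics_Metric_space[OF comp] .
  obtain L :: "'a \<Rightarrow> real" where L: "bounded (range L)" "\<And>x y. \<bar>L x - L y\<bar> \<le> 2 * d x y"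
    "\<And>x y. cost_inf g d f x y = 0 \<Longrightarrow> L x \<le> L y"
    "\<And>x y. cost_inf g d f x y = 0 \<Longrightarrow> 0 < cost_inf g d f y x \<Longrightarrow> L x < L y"
    using quasimetric_lyapunov[where E = "cost_inf g d f", OF comp pm cost_inf_nonneg[OF pm]
        cost_inf_le_dist[OF pm] cost_inf_triangle[OF pm]] by blast
  have uc: "uniformly_continuous_on UNIV L"
    using L(2) by (intro uniformly_continuous_on_gage[OF dg, where K = 2]) (auto simp: dist_real_def)
  have mono: "cost_rel g d f \<subseteq> le_rel L"
    using L(3) cost_rel_imp_cost_inf_eq_0[OF pm] by (auto simp: le_rel_def)
  have strict: "L y < L x" if "(y, x) \<in> cost_rel g d f" "(x, y) \<notin> cost_rel g d f" for x y
  proof (rule L(4))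
    show "cost_inf g d f y x = 0" using that cost_rel_imp_cost_inf_eq_0[OF pm] by blast
    \<comment> \<open>Here \<open>x\<close> and \<open>y\<close> differ, since otherwise the two
      memberships contradict each other, and \<open>d\<close> is a metric. So a vanishing infimum
      would be reached by nonempty chains and put \<open>(x, y)\<close> into the relation.\<close>
    have "0 < d x y" using that by (metis mdist_pos_eq UNIV_I)
    then show "0 < cost_inf g d f x y"
      using that(2) cost_inf_eq_0_imp_cost_rel cost_inf_nonneg[OF pm]
      by (metis order_le_imp_less_or_eq)
  qed
  have "lyapunov_function f L"
    using uniformly_continuous_imp_continuous[OF uc] subset_cost_rel[OF pm, of f] mono
    by (auto simp: lyapunov_function_def)
  moreover have "Lipschitz_continuous_map (metric (UNIV, d)) euclidean_metric L"
    using L(2) by (auto simp: Lipschitz_continuous_map_def dist_real_def)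
  moreover have "critical_set (cost_rel g d f) L = cyclic_set (cost_rel g d f)"
    by (rule critical_set_eq_cyclic_set) (use cost_rel_trans[OF pm] strict in blast)+
  ultimately show ?thesis
    using L(1) uc mono strict by (intro exI[of _ L]) (auto simp: le_rel_def)
qed

section \<open>Pseudo-metrization of entourages\<close>

text \<open>Of a path only the number of edges and the total length are kept: the number drives the
  strong induction of \<open>le_twice_path_length\<close>, and the length is what gets halved
  there.\<close>

inductive path_length :: "('a \<Rightarrow> 'a \<Rightarrow> real) \<Rightarrow> nat \<Rightarrow> 'a \<Rightarrow> 'a \<Rightarrow> real \<Rightarrow> bool" for h where
  empty: "path_length h 0 x x 0"
| step: "path_length h n x y s \<Longrightarrow> path_length h (Suc n) x z (s + h y z)"

lemma path_length_single: "path_length h (Suc 0) x y (h x y)"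
  using path_length.step[OF path_length.empty, of h x y] by simp

text \<open>The second path is the first premise because the induction runs over it: paths grow at
  their end.\<close>

lemma path_length_trans:
  assumes "path_length h m y z t" "path_length h n x y s"
  shows "path_length h (n + m) x z (s + t)"
  using assms
proof (induction rule: path_length.induct)
  case (empty y)
  then show ?case by simp
next
  case (step m y z' t z)
  from path_length.step[OF step.IH[OF step.prems], of z] show ?case
    by (simp add: add.assoc)
qed

lemma path_length_sym:
  assumes sym: "\<And>x y. h x y = h y x" and "path_length h n x y s"
  shows "path_length h n y x s"
  using assms(2)
proof (induction rule: path_length.induct)
  case (empty x)
  show ?case by (rule path_length.empty)
next
  case (step n x y s z)
  from path_length_trans[OF step.IH path_length_single[of h z y]] show ?case
    by (simp add: sym[of z y] add.commute)
qed

lemma path_length_nonneg: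
  assumes "\<And>x y. 0 \<le> h x y" and "path_length h n x y s"
  shows "0 \<le> s"
  using assms(2) by induction (simp_all add: assms(1))

text \<open>The edge from \<open>u\<close> to \<open>v\<close> is the last one whose preceding part
  has length at most \<open>t\<close>. Either the length exceeds \<open>t\<close> once this edge is
  passed, or the edge ends the path; in both cases at most \<open>s - t\<close> remains. Removing
  the edge leaves fewer edges on both sides.\<close>

lemma path_length_split:
  assumes nonneg: "\<And>x y. 0 \<le> h x y"
    and "path_length h n x y s" "0 < n" "0 \<le> t" "t \<le> s"
  shows "\<exists>u v n1 n2 s1 s2. path_length h n1 x u s1 \<and> path_length h n2 v y s2 \<and>
    n1 < n \<and> n2 < n \<and> s1 \<le> t \<and> s2 \<le> s - t \<and> h u v \<le> s"
  using assms(2-5)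
proof (induction rule: path_length.induct)
  case (empty x)
  then show ?case by simp
next
  case (step n x y s z)
  have "0 \<le> s" using path_length_nonneg[OF nonneg step.hyps] .
  show ?case
  proof (cases "s \<le> t")
    case True
    then show ?thesis
      using step.hyps path_length.empty[of h z] step.prems \<open>0 \<le> s\<close>
      by (intro exI[of _ y] exI[of _ z] exI[of _ n] exI[of _ "0::nat"] exI[of _ s] exI[of _ "0::real"])
        auto
  next
    case False
    have "n \<noteq> 0"
    proof
      assume "n = 0"
      with step.hyps have "s = 0" by (auto elim: path_length.cases)
      with False step.prems show False by simp
    qed
    then obtain u v n1 n2 s1 s2 where uv: "path_length h n1 x u s1" "path_length h n2 v y s2"
      "n1 < n" "n2 < n" "s1 \<le> t" "s2 \<le> s - t" "h u v \<le> s"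
      using step.IH step.prems False by auto
    have "path_length h (Suc n2) v z (s2 + h y z)" using uv by (intro path_length.step)
    moreover have "0 \<le> h y z" by (rule nonneg)
    ultimately show ?thesis
      using uv
      by (intro exI[of _ u] exI[of _ v] exI[of _ n1] exI[of _ "Suc n2"] exI[of _ s1]
          exI[of _ "s2 + h y z"]) auto
  qed
qed

text \<open>
  Splitting a path at the edge that crosses half of its length leaves two shorter paths of
  at most half the length.
\<close>

lemma le_twice_path_length:
  assumes nonneg: "\<And>x y. 0 \<le> h x y" and refl: "\<And>x. h x x = 0"
    and quasi: "\<And>x y z w r. h x y \<le> r \<Longrightarrow> h y z \<le> r \<Longrightarrow> h z w \<le> r \<Longrightarrow> h x w \<le> 2 * r"
    and "path_length h n x y s"
  shows "h x y \<le> 2 * s"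
  using assms(4)
proof (induction n arbitrary: x y s rule: less_induct)
  case (less n)
  have s: "0 \<le> s" using path_length_nonneg[OF nonneg less.prems] .
  show ?case
  proof (cases "n = 0")
    case True
    then have "x = y" using less.prems by (auto elim: path_length.cases)
    then show ?thesis using refl s by simp
  next
    case False
    then obtain u v n1 n2 s1 s2 where uv: "path_length h n1 x u s1" "path_length h n2 v y s2"
      "n1 < n" "n2 < n" "s1 \<le> s / 2" "s2 \<le> s - s / 2" "h u v \<le> s"
      using path_length_split[OF nonneg less.prems, of "s / 2"] s by auto
    \<comment> \<open>The induction hypothesis bounds the outer values by twice
      \<open>s / 2\<close>. Together with \<open>h u v \<le> s\<close> the quasi-triangle inequality
      applies at \<open>r = s\<close> and reproduces the factor 2.\<close>
    have "h x u \<le> s" "h v y \<le> s"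
      using less.IH[OF uv(3,1)] less.IH[OF uv(4,2)] uv(5,6) by auto
    then show ?thesis by (rule quasi[OF _ uv(7)])
  qed
qed

text \<open>The chain argument of Frink's metrization lemma: the infimum of path lengths is a
  pseudo-metric below \<open>h\<close> by construction, and \<open>le_twice_path_length\<close>
  keeps it above half of \<open>h\<close>.\<close>

lemma pseudometric_of_quasi_triangle:
  assumes nonneg: "\<And>x y. 0 \<le> h x y" and refl: "\<And>x. h x x = 0"
    and sym: "\<And>x y. h x y = h y x" and bound: "\<And>x y. h x y \<le> 1"
    and quasi: "\<And>x y z w r. h x y \<le> r \<Longrightarrow> h y z \<le> r \<Longrightarrow> h z w \<le> r \<Longrightarrow> h x w \<le> 2 * r"
  shows "\<exists>d. bounded_pseudometric d \<and> (\<forall>x y. d x y \<le> h x y \<and> h x y \<le> 2 * d x y)"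
proof -
  define S where "S x y = {s. \<exists>n. path_length h n x y s}" for x y
  define d where "d x y = Inf (S x y)" for x y
  have S_nonneg: "0 \<le> s" if "s \<in> S x y" for s x y
    using path_length_nonneg[of h, OF nonneg] that unfolding S_def by blast
  have bdd: "bdd_below (S x y)" for x y
    using S_nonneg by (rule bdd_belowI)
  have S_h: "h x y \<in> S x y" for x y
    using path_length_single[of h x y] unfolding S_def by blast
  have d_le: "d x y \<le> s" if "s \<in> S x y" for s x y
    unfolding d_def using that bdd by (rule cInf_lower)
  have d_ge: "r \<le> d x y" if "\<And>s. s \<in> S x y \<Longrightarrow> r \<le> s" for r x y
    unfolding d_def using S_h by (intro cInf_greatest that) auto
  have d_h: "d x y \<le> h x y" for x y
    using d_le S_h by blast
  have d_nonneg: "0 \<le> d x y" for x y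
    by (rule d_ge) (rule S_nonneg)
  have "bounded_pseudometric d"
    unfolding bounded_pseudometric_def
  proof (intro conjI allI)
    show "0 \<le> d x y" for x y by (rule d_nonneg)
    show "d x x = 0" for x using d_h[of x x] d_nonneg[of x x] refl by simp
    have "S x y \<subseteq> S y x" for x y
      using path_length_sym[of h, OF sym] unfolding S_def by blast
    then have "S x y = S y x" for x y by blast
    then show "d x y = d y x" for x y by (simp add: d_def)
    show "d x z \<le> d x y + d y z" for x y z
    proof -
      \<comment> \<open>The two infima are taken one after the other: over \<open>s\<close> with
        \<open>t\<close> fixed, then over \<open>t\<close>.\<close>
      have "d x z - t \<le> d x y" if t: "t \<in> S y z" for t
      proof (rule d_ge)
        fix s assume "s \<in> S x y"
        then obtain n m where "path_length h n x y s" "path_length h m y z t"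
          using t by (auto simp: S_def)
        from path_length_trans[OF this(2,1)] have "s + t \<in> S x z"
          by (auto simp: S_def)
        then show "d x z - t \<le> s" using d_le by fastforce
      qed
      then have "d x z - d x y \<le> t" if "t \<in> S y z" for t
        using that by fastforce
      then have "d x z - d x y \<le> d y z" by (rule d_ge)
      then show ?thesis by simp
    qed
    show "\<exists>B. \<forall>x y. d x y \<le> B"
      using order_trans[OF d_h bound] by (intro exI[of _ 1]) simp
  qed
  moreover have "h x y \<le> 2 * d x y" for x y
  proof -
    have "h x y / 2 \<le> s" if "s \<in> S x y" for s
    proof -
      obtain n where n: "path_length h n x y s" using \<open>s \<in> S x y\<close> by (auto simp: S_def)
      have "h x y \<le> 2 * s"
        by (rule le_twice_path_length[of h n]) (fact nonneg refl quasi n)+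
      then show ?thesis by simp
    qed
    then have "h x y / 2 \<le> d x y" by (rule d_ge)
    then show ?thesis by simp
  qed
  ultimately show ?thesis using d_h by (intro exI[of _ d]) simp
qed

section \<open>Normal sequences of entourages\<close>

lemma uniformity_refine:
  fixes E :: "'a::uniform_space \<times> 'a \<Rightarrow> bool"
  assumes "eventually E uniformity"
  shows "\<exists>D. eventually D uniformity \<and> (\<forall>x y. D (x, y) \<longrightarrow> D (y, x)) \<and>
    (\<forall>x y z w. D (x, y) \<longrightarrow> D (y, z) \<longrightarrow> D (z, w) \<longrightarrow> E (x, w))"
proof -
  obtain D1 where "eventually D1 uniformity \<and> (\<forall>x y z. D1 (x, y) \<longrightarrow> D1 (y, z) \<longrightarrow> E (x, z))"
    using uniformity_trans[OF assms] ..
  then have D1: "eventually D1 uniformity" "D1 (x, y) \<Longrightarrow> D1 (y, z) \<Longrightarrow> E (x, z)" for x y z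
    by simp_all
  obtain D2 where "eventually D2 uniformity \<and> (\<forall>x y z. D2 (x, y) \<longrightarrow> D2 (y, z) \<longrightarrow> D1 (x, z))"
    using uniformity_trans[OF D1(1)] ..
  then have D2: "eventually D2 uniformity" "D2 (x, y) \<Longrightarrow> D2 (y, z) \<Longrightarrow> D1 (x, z)" for x y z
    by simp_all
  define D where "D = (\<lambda>(x, y). D2 (x, y) \<and> D2 (y, x))"
  have "eventually D uniformity"
    using eventually_conj[OF D2(1) uniformity_sym[OF D2(1)]]
    by (rule eventually_mono) (auto simp: D_def)
  moreover have "D (y, x)" if "D (x, y)" for x y using that by (simp add: D_def)
  \<comment> \<open>Halving \<open>E\<close> twice allows four steps, and the diagonal pair
    \<open>(w, w)\<close> serves as the fourth. Three steps are what the path splitting consumes: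
    initial part, crossing edge, final part.\<close>
  moreover have "E (x, w)" if "D (x, y)" "D (y, z)" "D (z, w)" for x y z w
  proof (rule D1(2))
    show "D1 (x, z)" using that by (intro D2(2)[of x y z]) (simp_all add: D_def)
    show "D1 (z, w)"
      using that uniformity_refl[OF D2(1)] by (intro D2(2)[of z w w]) (simp_all add: D_def)
  qed
  ultimately show ?thesis by (intro exI[of _ D]) simp
qed

lemma uniformity_sequence:
  fixes E :: "'a::uniform_space \<times> 'a \<Rightarrow> bool"
  assumes "eventually E uniformity"
  shows "\<exists>W :: nat \<Rightarrow> 'a \<times> 'a \<Rightarrow> bool. (\<forall>n. eventually (W n) uniformity) \<and>
    (\<forall>n x y. W n (x, y) \<longrightarrow> W n (y, x)) \<and>
    (\<forall>n x y z w. W (Suc n) (x, y) \<longrightarrow> W (Suc n) (y, z) \<longrightarrow> W (Suc n) (z, w) \<longrightarrow> W n (x, w)) \<and>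
    (\<forall>x y. W 0 (x, y) \<longrightarrow> E (x, y))"
proof -
  define good where "good P D \<longleftrightarrow> eventually D uniformity \<and> (\<forall>x y. D (x, y) \<longrightarrow> D (y, x)) \<and>
    (\<forall>x y z w. D (x, y) \<longrightarrow> D (y, z) \<longrightarrow> D (z, w) \<longrightarrow> P (x, w))"
    for P D :: "'a \<times> 'a \<Rightarrow> bool"
  have ex: "\<exists>D. good P D" if "eventually P uniformity" for P
    unfolding good_def by (rule uniformity_refine[OF that])
  define F where "F P = (SOME D. good P D)" for P
  have F: "good P (F P)" if "eventually P uniformity" for P
    unfolding F_def by (rule someI_ex[OF ex[OF that]])
  \<comment> \<open>The exponent \<open>Suc n\<close> makes already \<open>W 0\<close> a refinement
    of \<open>E\<close>, so that every \<open>W n\<close> is symmetric, whether or not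
    \<open>E\<close> is.\<close>
  define W where "W n = (F ^^ Suc n) E" for n
  have ev: "eventually ((F ^^ n) E) uniformity" for n
  proof (induction n)
    case 0
    show ?case using assms by simp
  next
    case (Suc n)
    then show ?case using F[OF Suc] by (simp add: good_def)
  qed
  have good: "good ((F ^^ n) E) (W n)" for n
    using F[OF ev] by (simp add: W_def)
  \<comment> \<open>With \<open>P\<close> free, the last fact covers both \<open>P = E\<close> for
    \<open>n = 0\<close> and \<open>P = W m\<close> for \<open>n = Suc m\<close>.\<close>
  have W: "eventually (W n) uniformity" "W n (x, y) \<Longrightarrow> W n (y, x)"
    "(F ^^ n) E = P \<Longrightarrow> W n (x, y) \<Longrightarrow> W n (y, z) \<Longrightarrow> W n (z, w) \<Longrightarrow> P (x, w)" for P n x y z w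
    using good[of n] by (simp_all add: good_def)
  show ?thesis
  proof (intro exI[of _ W] conjI allI impI)
    show "W n (x, w)" if "W (Suc n) (x, y)" "W (Suc n) (y, z)" "W (Suc n) (z, w)" for n x y z w
      by (rule W(3)[OF _ that]) (simp add: W_def)
    show "E (x, y)" if "W 0 (x, y)" for x y
      by (rule W(3)[of 0 E x y y y, OF _ that]) (simp_all add: uniformity_refl[OF W(1)])
  qed (rule W, assumption?)+
qed

text \<open>This is why the gage generates the uniformity. A normal sequence below \<open>E\<close>
  gives a dyadic-valued \<open>h\<close> to which the chain argument applies. The radius
  \<open>1 / 2\<close> comes from \<open>h x y \<le> 2 * d x y\<close>: it ensures
  \<open>h x y < 1\<close>, which means \<open>W 0 (x, y)\<close>.\<close>

lemma gage_entourage: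
  fixes E :: "'a::uniform_space \<times> 'a \<Rightarrow> bool"
  assumes "eventually E uniformity"
  shows "\<exists>d\<in>gage. \<forall>x y. d x y < 1 / 2 \<longrightarrow> E (x, y)"
proof -
  obtain W :: "nat \<Rightarrow> 'a \<times> 'a \<Rightarrow> bool" where W': "(\<forall>n. eventually (W n) uniformity) \<and>
    (\<forall>n x y. W n (x, y) \<longrightarrow> W n (y, x)) \<and>
    (\<forall>n x y z w. W (Suc n) (x, y) \<longrightarrow> W (Suc n) (y, z) \<longrightarrow> W (Suc n) (z, w) \<longrightarrow> W n (x, w)) \<and>
    (\<forall>x y. W 0 (x, y) \<longrightarrow> E (x, y))"
    using uniformity_sequence[OF assms] ..
  have W: "eventually (W n) uniformity" "W n (x, y) \<Longrightarrow> W n (y, x)"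
    "W (Suc n) (x, y) \<Longrightarrow> W (Suc n) (y, z) \<Longrightarrow> W (Suc n) (z, w) \<Longrightarrow> W n (x, w)"
    "W 0 (x, y) \<Longrightarrow> E (x, y)" for n x y z w
    using W' by blast+
  have W_refl: "W n (x, x)" for n x using uniformity_refl[OF W(1)] .
  have W_Suc: "W n (x, y)" if "W (Suc n) (x, y)" for n x y
    using W(3)[OF that W_refl W_refl] .
  have W_antimono: "W m (x, y)" if "W n (x, y)" "m \<le> n" for m n x y
    using that(2,1) by (induction rule: dec_induct) (simp_all add: W_Suc)
  \<comment> \<open>The exponent is the first level at which the pair fails, so that
    \<open>h x y < (1/2) ^ n\<close> says exactly \<open>W n (x, y)\<close>. Pairs that never fail
    have no such level and get the value 0.\<close>
  define h where "h x y = (if \<forall>n. W n (x, y) then 0 else (1/2::real) ^ (LEAST n. \<not> W n (x, y)))"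
    for x y
  have h_less: "h x y < (1/2) ^ n \<longleftrightarrow> W n (x, y)"
    and h_le: "W n (x, y) \<Longrightarrow> h x y \<le> (1/2) ^ Suc n" for n x y
  proof -
    have "(h x y < (1/2) ^ n \<longleftrightarrow> W n (x, y)) \<and> (W n (x, y) \<longrightarrow> h x y \<le> (1/2) ^ Suc n)"
    proof (cases "\<forall>n. W n (x, y)")
      case True
      then show ?thesis by (simp add: h_def)
    next
      case False
      define m where "m = (LEAST n. \<not> W n (x, y))"
      have m: "\<not> W m (x, y)" "\<And>k. k < m \<Longrightarrow> W k (x, y)"
        using False LeastI_ex[of "\<lambda>n. \<not> W n (x, y)"] not_less_Least unfolding m_def by auto
      have Wn: "W n (x, y) \<longleftrightarrow> n < m"
        using m W_antimono[of n x y m] by (cases "n < m") auto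
      have h: "h x y = (1/2) ^ m"
        using False by (simp only: h_def m_def if_False)
      have "(1/2::real) ^ m < (1/2) ^ n \<longleftrightarrow> n < m"
        by (subst power_strict_decreasing_iff) auto
      moreover have "(1/2::real) ^ m \<le> (1/2) ^ Suc n \<longleftrightarrow> Suc n \<le> m"
        by (subst power_decreasing_iff) auto
      ultimately show ?thesis unfolding Wn h by linarith
    qed
    then show "h x y < (1/2) ^ n \<longleftrightarrow> W n (x, y)" "W n (x, y) \<Longrightarrow> h x y \<le> (1/2) ^ Suc n"
      by blast+
  qed
  have h_bound: "h x y \<le> 1" for x y
    by (simp add: h_def power_le_one)
  have h_nonneg: "0 \<le> h x y" for x y by (simp add: h_def)
  have h_refl: "h x x = 0" for x by (simp add: h_def W_refl)
  have "W n (x, y) = W n (y, x)" for n x y using W(2) by blast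
  then have h_sym: "h x y = h y x" for x y by (simp add: h_def)
  have h_quasi: "h x w \<le> 2 * r" if r: "h x y \<le> r" "h y z \<le> r" "h z w \<le> r" for x y z w r
  proof -
    \<comment> \<open>Composing three pairs costs one level, but the dyadic values win it back:
      membership in \<open>W j\<close> gives \<open>h x w \<le> (1/2) ^ Suc j\<close>.\<close>
    have step: "h x w \<le> (1/2) ^ k" if "r < (1/2) ^ k" for k
    proof (cases k)
      case 0
      then show ?thesis using h_bound by simp
    next
      case (Suc j)
      have "h x y < (1/2) ^ k" "h y z < (1/2) ^ k" "h z w < (1/2) ^ k"
        using that r by linarith+
      then have "W j (x, w)"
        unfolding h_less Suc by (rule W(3))
      then show ?thesis using h_le Suc by simp
    qed
    have "0 \<le> r" using r(1) h_nonneg order_trans by blast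
    then consider "r = 0" | "1 \<le> r" | "0 < r" "r < 1" by linarith
    then show ?thesis
    proof cases
      case 1
      have "h x w \<le> 0"
      proof (rule field_le_epsilon)
        fix e :: real assume "0 < e"
        then obtain k where "(1/2) ^ k < e" using real_arch_pow_inv[of e "1/2"] by auto
        then show "h x w \<le> 0 + e" using step[of k] 1 by auto
      qed
      then show ?thesis using 1 by simp
    next
      case 2
      then show ?thesis using h_bound[of x w] by simp
    next
      case 3
      \<comment> \<open>The least such \<open>n\<close> brackets \<open>r\<close>:
        \<open>(1/2) ^ n \<le> r < (1/2) ^ (n - 1)\<close>, and the upper end is at most
        \<open>2 * r\<close>. It is positive because \<open>r < 1\<close>.\<close>
      define n where "n = (LEAST n. (1/2) ^ n \<le> r)"
      have "\<exists>n. (1/2) ^ n < r" using real_arch_pow_inv[OF 3(1), of "1/2"] by simp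
      then have "\<exists>n. (1/2) ^ n \<le> r" using less_imp_le by (elim exE, intro exI)
      then have n: "(1/2) ^ n \<le> r" unfolding n_def by (rule LeastI_ex)
      then obtain k where k: "n = Suc k" using 3 by (cases n) auto
      have "r < (1/2) ^ k"
        using not_less_Least[of k "\<lambda>n. (1/2) ^ n \<le> r"] k n_def by (simp add: not_le)
      from step[OF this] show ?thesis using n k by simp
    qed
  qed
  have "\<exists>d. bounded_pseudometric d \<and> (\<forall>x y. d x y \<le> h x y \<and> h x y \<le> 2 * d x y)"
    by (rule pseudometric_of_quasi_triangle) (fact h_nonneg h_refl h_sym h_bound h_quasi)+
  then obtain d where d': "bounded_pseudometric d \<and> (\<forall>x y. d x y \<le> h x y \<and> h x y \<le> 2 * d x y)" ..
  then have d: "bounded_pseudometric d" "d x y \<le> h x y" "h x y \<le> 2 * d x y" for x y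
    by simp_all
  have "eventually (\<lambda>(x, y). d x y < \<epsilon>) uniformity" if \<epsilon>: "0 < \<epsilon>" for \<epsilon>
  proof -
    obtain n where n: "(1/2) ^ n < \<epsilon>" using real_arch_pow_inv[of \<epsilon> "1/2"] \<epsilon> by auto
    have "d x y < \<epsilon>" if "W n (x, y)" for x y
    proof -
      have "d x y \<le> (1/2) ^ Suc n" using h_le[OF that] d(2)[of x y] by linarith
      also have "\<dots> \<le> (1/2) ^ n" by simp
      finally show ?thesis using n by simp
    qed
    then show ?thesis by (intro eventually_mono[OF W(1)[of n]]) auto
  qed
  then have "d \<in> gage" using d(1) by (simp add: gage_def)
  moreover have "E (x, y)" if "d x y < 1 / 2" for x y
  proof -
    have "h x y < (1/2) ^ 0" using d(3)[of x y] that by simp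
    then have "W 0 (x, y)" unfolding h_less .
    then show ?thesis by (rule W(4))
  qed
  ultimately show ?thesis by (intro bexI[of _ d]) simp
qed

section \<open>A single metric computing both chain relations\<close>

lemma zero_in_gage: "(\<lambda>_ _. 0) \<in> gage"
  by (auto simp: gage_def bounded_pseudometric_def case_prod_unfold)

text \<open>A sum with weights \<open>(1/2) ^ n / B n\<close> over an enumeration of
  \<open>D\<close> converges uniformly, so finitely many terms decide whether it is small and it
  stays in the gage. Each term is at most the sum, so \<open>2 ^ n * B n\<close> is a constant for
  the \<open>n\<close>-th member.\<close>

lemma gage_dominating_countable:
  fixes D :: "('a::uniform_space \<Rightarrow> 'a \<Rightarrow> real) set"
  assumes "countable D" "D \<subseteq> gage"
  shows "\<exists>d\<in>gage. \<forall>e\<in>D. \<exists>K>0. \<forall>x y. e x y \<le> K * d x y"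
proof -
  \<comment> \<open>Inserting the zero pseudo-metric leaves something to enumerate when
    \<open>D\<close> is empty.\<close>
  define e where "e = from_nat_into (insert (\<lambda>_ _. 0) D)"
  have range_e: "range e = insert (\<lambda>_ _. 0) D"
    unfolding e_def using assms by (intro range_from_nat_into) auto
  then have e_gage: "e n \<in> gage" for n
    using assms zero_in_gage by (metis insert_subset rangeI subsetD)
  note e_pm = gage_bounded_pseudometric[OF e_gage]
  have "\<exists>B>0. \<forall>x y. e n x y \<le> B" for n
  proof -
    obtain B where "\<And>x y. e n x y \<le> B"
      using e_pm[of n] unfolding bounded_pseudometric_def by blast
    then show ?thesis
      by (intro exI[of _ "max 1 B"]) (auto simp: le_max_iff_disj)
  qed
  then obtain B where B: "\<And>n. 0 < B n" "\<And>n x y. e n x y \<le> B n" by metis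
  define v where "v x y n = (1/2) ^ n * (e n x y / B n)" for x y n
  define d where "d x y = suminf (v x y)" for x y
  have v_nonneg: "0 \<le> v x y n" for x y n
    using B(1)[of n] bounded_pseudometricD(1)[OF e_pm] by (simp add: v_def)
  have v_le: "v x y n \<le> (1/2) ^ n" for x y n
    using B(1)[of n] B(2)[of n x y] by (simp add: v_def field_simps)
  have geo: "summable (\<lambda>n. (1/2::real) ^ n)" "(\<Sum>n. (1/2::real) ^ n) = 2"
    using geometric_sums[of "1/2 :: real"] by (simp_all add: sums_iff)
  have summ: "summable (v x y)" for x y
    by (rule summable_comparison_test'[OF geo(1), of 0]) (use v_nonneg v_le in simp)
  have "bounded_pseudometric d"
    unfolding bounded_pseudometric_def
  proof (intro conjI allI)
    show "0 \<le> d x y" for x y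
      unfolding d_def by (rule suminf_nonneg[OF summ v_nonneg])
    show "d x x = 0" for x
      using bounded_pseudometricD(2)[OF e_pm] by (simp add: d_def v_def[abs_def])
    show "d x y = d y x" for x y
      using bounded_pseudometricD(3)[OF e_pm, of _ x y] by (simp add: d_def v_def[abs_def])
    show "d x z \<le> d x y + d y z" for x y z
    proof -
      have "v x z n \<le> v x y n + v y z n" for n
      proof -
        have "(1/2) ^ n * (e n x z / B n) \<le> (1/2) ^ n * ((e n x y + e n y z) / B n)"
          using bounded_pseudometricD(4)[OF e_pm, of n x z y] B(1)[of n]
          by (intro mult_left_mono divide_right_mono) auto
        then show ?thesis by (simp add: v_def add_divide_distrib distrib_left)
      qed
      from suminf_le[OF this summ summable_add[OF summ summ]] show ?thesis
        unfolding d_def suminf_add[OF summ summ] .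
    qed
    show "\<exists>B. \<forall>x y. d x y \<le> B"
      using suminf_le[OF v_le summ geo(1)] unfolding d_def by blast
  qed
  moreover have "eventually (\<lambda>(x, y). d x y < \<epsilon>) uniformity" if \<epsilon>: "0 < \<epsilon>" for \<epsilon>
  proof -
    \<comment> \<open>The tail from \<open>N\<close> on is at most \<open>2 * (1/2) ^ N\<close>,
      below \<open>\<epsilon> / 2\<close>; the first \<open>N\<close> terms share the other half,
      each staying below \<open>\<delta>\<close>. The summand 1 in \<open>\<delta>\<close> covers
      \<open>N = 0\<close>.\<close>
    obtain N where N: "(1/2) ^ N < \<epsilon> / 4" using real_arch_pow_inv[of "\<epsilon> / 4" "1/2"] \<epsilon> by auto
    define \<delta> where "\<delta> = \<epsilon> / (2 * (real N + 1))"
    have \<delta>: "0 < \<delta>" "real N * \<delta> < \<epsilon> / 2" using \<epsilon> by (auto simp: \<delta>_def field_simps)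
    have "eventually (\<lambda>(x, y). v x y n < \<delta>) uniformity" for n
    proof -
      have "v x y n < \<delta>" if "e n x y < \<delta> * B n" for x y
      proof -
        have "v x y n \<le> 1 * (e n x y / B n)"
          unfolding v_def using B(1)[of n] bounded_pseudometricD(1)[OF e_pm]
          by (intro mult_right_mono) (auto simp: power_le_one)
        also have "\<dots> < \<delta>" using that B(1)[of n] by (simp add: field_simps)
        finally show ?thesis .
      qed
      then show ?thesis
        using gage_eventually[OF e_gage[of n], of "\<delta> * B n"] \<delta>(1) B(1)[of n]
        by (auto elim!: eventually_mono)
    qed
    then have "eventually (\<lambda>p. \<forall>n\<in>{..<N}. case p of (x, y) \<Rightarrow> v x y n < \<delta>) uniformity"
      by (intro eventually_ball_finite) auto
    then show ?thesis
    proof (rule eventually_mono, clarify)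
      fix x y assume small: "\<forall>n\<in>{..<N}. v x y n < \<delta>"
      have "d x y = (\<Sum>n. v x y (n + N)) + sum (v x y) {..<N}"
        unfolding d_def by (rule suminf_split_initial_segment[OF summ])
      moreover have "sum (v x y) {..<N} \<le> real N * \<delta>"
        using sum_bounded_above[of "{..<N}" "v x y" \<delta>] small by (auto intro: less_imp_le)
      moreover have "(\<Sum>n. v x y (n + N)) \<le> (\<Sum>n. (1/2) ^ n * (1/2) ^ N)"
      proof (rule suminf_le)
        show "v x y (n + N) \<le> (1/2) ^ n * (1/2) ^ N" for n
          using v_le[of x y "n + N"] by (simp add: power_add)
      qed (rule summable_ignore_initial_segment[OF summ] summable_mult2[OF geo(1)])+
      moreover have "(\<Sum>n. (1/2) ^ n * (1/2) ^ N) = 2 * (1/2::real) ^ N"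
        using suminf_mult2[OF geo(1), of "(1/2) ^ N"] geo(2) by simp
      ultimately show "d x y < \<epsilon>" using N \<delta>(2) by linarith
    qed
  qed
  ultimately have "d \<in> gage" by (simp add: gage_def)
  moreover have "\<exists>K>0. \<forall>x y. e' x y \<le> K * d x y" if "e' \<in> D" for e'
  proof -
    have "e' \<in> range e" unfolding range_e using that by simp
    then obtain n where n: "e' = e n" by blast
    have "e n x y \<le> (2 ^ n * B n) * d x y" for x y
    proof -
      have "v x y n \<le> d x y"
        unfolding d_def using sum_le_suminf[OF summ, of "{n}" x y] v_nonneg by simp
      then show ?thesis using B(1)[of n] by (simp add: v_def field_simps power_one_over)
    qed
    then show ?thesis using n B(1)[of n] by (intro exI[of _ "2 ^ n * B n"]) auto
  qed
  ultimately show ?thesis by (intro bexI[of _ d] ballI)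
qed

text \<open>Lindelof's theorem selects countably many of the sets; choosing an index for each makes
  the index set countable too.\<close>

lemma countable_subfamily_same_Union:
  fixes W :: "'i \<Rightarrow> 'b::second_countable_topology set"
  assumes "\<And>i. i \<in> I \<Longrightarrow> open (W i)"
  shows "\<exists>J\<subseteq>I. countable J \<and> (\<Union>i\<in>J. W i) = (\<Union>i\<in>I. W i)"
proof -
  obtain F where F: "F \<subseteq> W ` I" "countable F" "\<Union>F = \<Union>(W ` I)"
    using Lindelof[of "W ` I"] assms by blast
  then obtain J where "J \<subseteq> I" "countable J" "F = W ` J"
    using countable_subset_image[of F W I] by auto
  then show ?thesis using F(3) by (intro exI[of _ J]) simp
qed

text \<open>The interior of \<open>U\<close> in the topology of the single pseudo-metric
  \<open>d\<close>. It allows the topologies of different members of the gage to be compared as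
  sets.\<close>

definition gage_interior :: "'a set \<Rightarrow> ('a \<Rightarrow> 'a \<Rightarrow> real) \<Rightarrow> 'a set" where
  "gage_interior U d = {x. \<exists>\<epsilon>>0. \<forall>y. d x y < \<epsilon> \<longrightarrow> y \<in> U}"

lemma gage_interior_subset:
  assumes "d \<in> gage"
  shows "gage_interior U d \<subseteq> U"
  using bounded_pseudometricD(2)[OF gage_bounded_pseudometric[OF assms]]
  by (auto simp: gage_interior_def)

lemma open_gage_interior:
  assumes d: "d \<in> gage"
  shows "open (gage_interior U d)"
  unfolding open_uniformity
proof
  fix x assume "x \<in> gage_interior U d"
  then obtain \<epsilon> where \<epsilon>: "0 < \<epsilon>" "\<And>y. d x y < \<epsilon> \<Longrightarrow> y \<in> U"
    by (auto simp: gage_interior_def)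
  have "y \<in> gage_interior U d" if y: "d x y < \<epsilon> / 2" for y
  proof -
    have "z \<in> U" if "d y z < \<epsilon> / 2" for z
      using bounded_pseudometricD(4)[OF gage_bounded_pseudometric[OF d], of x z y] y that
      by (intro \<epsilon>(2)) simp
    then show ?thesis using \<epsilon>(1) by (auto simp: gage_interior_def intro!: exI[of _ "\<epsilon> / 2"])
  qed
  then show "eventually (\<lambda>(x', y). x' = x \<longrightarrow> y \<in> gage_interior U d) uniformity"
    using gage_eventually[OF d, of "\<epsilon> / 2"] \<epsilon>(1) by (auto elim!: eventually_mono)
qed

text \<open>For \<open>x\<close> in an open \<open>U\<close>, the pairs \<open>(x', y)\<close> with
  \<open>y \<in> U\<close> whenever \<open>x' = x\<close> form an entourage, and
  \<open>gage_entourage\<close> places a ball around \<open>x\<close> inside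
  \<open>U\<close>.\<close>

lemma UN_gage_interior:
  fixes U :: "'a::uniform_space set"
  assumes "open U"
  shows "(\<Union>d\<in>gage. gage_interior U d) = U"
proof
  show "(\<Union>d\<in>gage. gage_interior U d) \<subseteq> U"
    by (intro UN_least gage_interior_subset)
  show "U \<subseteq> (\<Union>d\<in>gage. gage_interior U d)"
  proof
    fix x assume "x \<in> U"
    define E where "E = (\<lambda>(x', y). x' = x \<longrightarrow> y \<in> U)"
    have "eventually E uniformity"
      using assms \<open>x \<in> U\<close> by (simp add: open_uniformity E_def)
    from gage_entourage[OF this] obtain d
      where d: "d \<in> gage" "\<forall>x y. d x y < 1 / 2 \<longrightarrow> E (x, y)" by (elim bexE)
    have "y \<in> U" if "d x y < 1 / 2" for y
      using d(2)[rule_format, OF that] by (simp add: E_def)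
    then have "x \<in> gage_interior U d"
      unfolding gage_interior_def by (intro CollectI exI[of _ "1 / 2"]) simp
    from UN_I[of d gage x "gage_interior U", OF d(1) this]
    show "x \<in> (\<Union>d\<in>gage. gage_interior U d)" .
  qed
qed

text \<open>Membership in the gage makes the topology of \<open>d\<close> coarser than the given
  one, and \<open>top\<close> makes it finer. Positivity off the diagonal comes from separation: an
  open set around \<open>x\<close> that misses \<open>y\<close> contains a ball around
  \<open>x\<close>.\<close>

lemma compatible_metricsI:
  fixes d :: "'a::{uniform_space, t2_space} \<Rightarrow> 'a \<Rightarrow> real"
  assumes d: "d \<in> gage" and top: "\<And>U x. open U \<Longrightarrow> x \<in> U \<Longrightarrow> x \<in> gage_interior U d"
  shows "d \<in> compatible_metrics"
proof -
  note pm = gage_bounded_pseudometric[OF d]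
  have pos: "0 < d x y" if neq: "x \<noteq> y" for x y
  proof -
    obtain U where "open U" "x \<in> U" "y \<notin> U" using separation_t1 neq by metis
    then obtain \<epsilon> where "0 < \<epsilon>" "\<not> d x y < \<epsilon>"
      using top[of U x] by (auto simp: gage_interior_def)
    then show ?thesis by linarith
  qed
  interpret Metric_space UNIV d
  proof
    show "0 \<le> d x y" "d x y = d y x" for x y using bounded_pseudometricD[OF pm] by auto
    show "d x y = 0 \<longleftrightarrow> x = y" for x y
      using pos[of x y] bounded_pseudometricD(2)[OF pm] by (cases "x = y") auto
    show "d x z \<le> d x y + d y z" for x y z by (rule bounded_pseudometricD(4)[OF pm])
  qed
  have "mbounded UNIV"
    using pm unfolding mbounded_alt bounded_pseudometric_def by auto
  moreover have "openin mtopology U \<longleftrightarrow> open U" for U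
  proof
    assume "open U"
    then show "openin mtopology U"
      using top[of U] by (auto simp: openin_mtopology gage_interior_def subset_iff)
  next
    assume "openin mtopology U"
    then have "U \<subseteq> gage_interior U d"
      by (auto simp: openin_mtopology gage_interior_def subset_iff)
    with gage_interior_subset[OF d] open_gage_interior[OF d] show "open U"
      by (metis subset_antisym)
  qed
  then have "mtopology = euclidean" by (simp add: topology_eq)
  ultimately show ?thesis by (simp add: compatible_metrics_def Metric_space_axioms)
qed

lemma gage_interior_scale:
  assumes "0 < K" and "\<And>x y. e x y \<le> K * d x y"
  shows "gage_interior U e \<subseteq> gage_interior U d"
proof
  fix x assume "x \<in> gage_interior U e"
  then obtain \<epsilon> where \<epsilon>: "0 < \<epsilon>" "\<And>y. e x y < \<epsilon> \<Longrightarrow> y \<in> U"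
    by (auto simp: gage_interior_def)
  have "y \<in> U" if "d x y < \<epsilon> / K" for y
    using that assms(2)[of x y] assms(1) by (intro \<epsilon>(2)) (simp add: field_simps)
  then show "x \<in> gage_interior U d"
    using \<epsilon>(1) assms(1) by (auto simp: gage_interior_def intro!: exI[of _ "\<epsilon> / K"])
qed

text \<open>The complements are open in the product \<open>'a \<times> 'a\<close>, which is second
  countable, so countably many of them have the same union.\<close>

lemma (in chain_cost) countable_gage_cost_rel:
  fixes f :: "('a::{uniform_space, second_countable_topology} \<times> 'a) set"
  shows "\<exists>D\<subseteq>gage. countable D \<and> (\<Inter>d\<in>D. cost_rel g d f) = (\<Inter>d\<in>gage. cost_rel g d f)"
proof -
  have "\<exists>D\<subseteq>gage. countable D \<and> (\<Union>d\<in>D. - cost_rel g d f) = (\<Union>d\<in>gage. - cost_rel g d f)"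
    by (rule countable_subfamily_same_Union) (rule open_Compl_cost_rel)
  then show ?thesis by (simp only: Compl_INT[symmetric] Compl_eq_Compl_iff)
qed

lemma gage_metric_chain_rel:
  fixes f :: "('a::{uniform_space, t2_space, second_countable_topology} \<times> 'a) set"
  obtains d where "d \<in> compatible_metrics \<inter> gage"
    "achain_rel f = cost_rel (+) d f" "chain_rel f = cost_rel max d f"
proof -
  have "\<exists>A\<subseteq>gage. countable A \<and> (\<Inter>d\<in>A. cost_rel (+) d f) = achain_rel f"
    unfolding achain_rel_def achain_rel_d_eq by (rule sum_cost.countable_gage_cost_rel)
  then obtain A where A: "A \<subseteq> gage" "countable A" "(\<Inter>d\<in>A. cost_rel (+) d f) = achain_rel f"
    by (elim exE conjE)
  have "\<exists>C\<subseteq>gage. countable C \<and> (\<Inter>d\<in>C. cost_rel max d f) = chain_rel f"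
    unfolding chain_rel_def chain_rel_d_eq by (rule max_cost.countable_gage_cost_rel)
  then obtain C where C: "C \<subseteq> gage" "countable C" "(\<Inter>d\<in>C. cost_rel max d f) = chain_rel f"
    by (elim exE conjE)
  obtain \<B> :: "'a set set" where \<B>: "countable \<B>" "topological_basis \<B>"
    using ex_countable_basis by blast
  have "\<exists>T\<subseteq>gage. countable T \<and> (\<Union>d\<in>T. gage_interior U d) = (\<Union>d\<in>gage. gage_interior U d)"
    for U :: "'a set"
    by (rule countable_subfamily_same_Union) (rule open_gage_interior)
  then have "\<forall>U. \<exists>T\<subseteq>gage. countable T \<and>
      (\<Union>d\<in>T. gage_interior U d) = (\<Union>d\<in>gage. gage_interior (U :: 'a set) d)" ..
  from choice[OF this] obtain T where T': "\<forall>U :: 'a set. T U \<subseteq> gage \<and> countable (T U) \<and>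
      (\<Union>d\<in>T U. gage_interior U d) = (\<Union>d\<in>gage. gage_interior U d)" ..
  have T: "T U \<subseteq> gage" "countable (T U)"
    "(\<Union>d\<in>T U. gage_interior U d) = (\<Union>d\<in>gage. gage_interior U d)" for U
    using T'[rule_format, of U] by simp_all
  \<comment> \<open>\<open>A\<close> and \<open>C\<close> determine the two relations, and the
    families \<open>T U\<close> for basic open \<open>U\<close> determine the topology. One
    \<open>d\<close> that dominates all of them computes everything at once.\<close>
  define D where "D = A \<union> C \<union> (\<Union>U\<in>\<B>. T U)"
  have "countable D"
    unfolding D_def by (intro countable_Un countable_UN A(2) C(2) T(2) \<B>(1))
  moreover have "D \<subseteq> gage"
    unfolding D_def by (intro Un_least UN_least A(1) C(1) T(1))
  ultimately obtain d where d: "d \<in> gage" and dom: "\<forall>e\<in>D. \<exists>K>0. \<forall>x y. e x y \<le> K * d x y"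
    using gage_dominating_countable[of D] by auto
  have "cost_rel (+) d f \<subseteq> cost_rel (+) e f" "cost_rel max d f \<subseteq> cost_rel max e f"
    if e: "e \<in> D" for e
  proof -
    obtain K where K: "0 < K" "\<And>x y. e x y \<le> K * d x y" using dom e by auto
    show "cost_rel (+) d f \<subseteq> cost_rel (+) e f" by (rule sum_cost.cost_rel_scale[OF K])
    show "cost_rel max d f \<subseteq> cost_rel max e f" by (rule max_cost.cost_rel_scale[OF K])
  qed
  then have "cost_rel (+) d f \<subseteq> achain_rel f" "cost_rel max d f \<subseteq> chain_rel f"
    unfolding A(3)[symmetric] C(3)[symmetric] D_def by (intro INT_greatest; simp)+
  moreover have "achain_rel f \<subseteq> cost_rel (+) d f"
    using d by (auto simp: achain_rel_def achain_rel_d_eq)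
  moreover have "chain_rel f \<subseteq> cost_rel max d f"
    using d by (auto simp: chain_rel_def chain_rel_d_eq)
  moreover have "d \<in> compatible_metrics"
  proof (rule compatible_metricsI[OF d])
    fix U x assume "open (U :: 'a set)" "x \<in> U"
    then obtain V where V: "V \<in> \<B>" "x \<in> V" "V \<subseteq> U"
      using topological_basisE[OF \<B>(2)] by blast
    \<comment> \<open>Some \<open>e\<close> in \<open>T V\<close> has a ball around \<open>x\<close>
      inside \<open>V\<close>; as \<open>d\<close> dominates \<open>e\<close> up to a constant, a
      ball of \<open>d\<close> fits as well.\<close>
    have "x \<in> (\<Union>d\<in>T V. gage_interior V d)"
      using V(2) unfolding T(3) UN_gage_interior[OF topological_basis_open[OF \<B>(2) V(1)]] .
    then obtain e where e: "e \<in> T V" "x \<in> gage_interior V e" by (elim UN_E)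
    have "e \<in> D" using e(1) V(1) by (auto simp: D_def)
    with dom obtain K where K: "0 < K" "\<And>x y. e x y \<le> K * d x y" by auto
    have "x \<in> gage_interior V d" using e(2) gage_interior_scale[OF K] by (rule subsetD[rotated])
    then show "x \<in> gage_interior U d" using V(3) by (auto simp: gage_interior_def)
  qed
  ultimately show thesis using d by (intro that[of d] subset_antisym IntI)
qed

section \<open>Lyapunov functions for both chain relations from one metric\<close>

theorem theorem5p12:
  fixes f :: "('a::{uniform_space, t2_space, second_countable_topology} \<times> 'a) set"
  shows "\<exists>Ll Lm :: 'a \<Rightarrow> real.
    lyapunov_function f Ll \<and> bounded (range Ll) \<and> uniformly_continuous_on UNIV Ll \<and>
    lyapunov_function f Lm \<and> bounded (range Lm) \<and> uniformly_continuous_on UNIV Lm \<and>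
    Id \<union> achain_rel f \<subseteq> le_rel Ll \<and>
    Id \<union> chain_rel f \<subseteq> le_rel Lm \<and>
    (\<forall>x y. (y, x) \<in> achain_rel f \<longrightarrow> (x, y) \<notin> achain_rel f \<longrightarrow> Ll y < Ll x) \<and>
    (\<forall>x y. (y, x) \<in> chain_rel f \<longrightarrow> (x, y) \<notin> chain_rel f \<longrightarrow> Lm y < Lm x) \<and>
    critical_set (achain_rel f) Ll = cyclic_set (achain_rel f) \<and>
    critical_set (chain_rel f) Lm = cyclic_set (chain_rel f) \<and>
    (\<exists>d \<in> compatible_metrics \<inter> gage.
       Lipschitz_continuous_map (metric (UNIV, d)) euclidean_metric Ll \<and>
       Lipschitz_continuous_map (metric (UNIV, d)) euclidean_metric Lm \<and>
       achain_rel f = achain_rel_d d f \<and>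
       chain_rel f = chain_rel_d d f)"
proof -
  \<comment> \<open>Both relations are computed by this one \<open>d\<close>, so the two instances
    of \<open>lyapunov_exists\<close> yield functions that are Lipschitz for the same
    metric.\<close>
  obtain d :: "'a \<Rightarrow> 'a \<Rightarrow> real" where d: "d \<in> compatible_metrics \<inter> gage"
    and eq: "achain_rel f = cost_rel (+) d f" "chain_rel f = cost_rel max d f"
    using gage_metric_chain_rel by blast
  obtain Ll where "lyapunov_function f Ll" "bounded (range Ll)" "uniformly_continuous_on UNIV Ll"
    "Id \<union> achain_rel f \<subseteq> le_rel Ll"
    "\<forall>x y. (y, x) \<in> achain_rel f \<longrightarrow> (x, y) \<notin> achain_rel f \<longrightarrow> Ll y < Ll x"
    "critical_set (achain_rel f) Ll = cyclic_set (achain_rel f)"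
    "Lipschitz_continuous_map (metric (UNIV, d)) euclidean_metric Ll"
    using sum_cost.lyapunov_exists[OF d, of f] unfolding eq by (elim exE conjE)
  moreover obtain Lm where "lyapunov_function f Lm" "bounded (range Lm)"
    "uniformly_continuous_on UNIV Lm" "Id \<union> chain_rel f \<subseteq> le_rel Lm"
    "\<forall>x y. (y, x) \<in> chain_rel f \<longrightarrow> (x, y) \<notin> chain_rel f \<longrightarrow> Lm y < Lm x"
    "critical_set (chain_rel f) Lm = cyclic_set (chain_rel f)"
    "Lipschitz_continuous_map (metric (UNIV, d)) euclidean_metric Lm"
    using max_cost.lyapunov_exists[OF d, of f] unfolding eq by (elim exE conjE)
  moreover have "achain_rel f = achain_rel_d d f" "chain_rel f = chain_rel_d d f"
    using eq by (simp_all add: achain_rel_d_eq chain_rel_d_eq)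
  ultimately show ?thesis
    using d by - (rule exI[of _ Ll], rule exI[of _ Lm], intro conjI bexI[of _ d], assumption+)
qed

end
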